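(* Let $\mu\in ID(\mathbb{R})$ satisfy $\mu((-\infty,0))=0$ and not be a Dirac measure. Then $\Phi_\mu$ is one-to-one on $\mathfrak{M}^1_L(\mathbb{R}^+)$, and $\Phi_\mu(\mathfrak{M}^1_L(\mathbb{R}^+))\subsetneq\mathfrak{M}^1_L(\mathbb{R}^+)$.
   Context: For $\mu\in ID(\mathbb{R})$ with characteristic exponent $\phi$, $\mu^s$ is the law with characteristic function $e^{s\phi}$. $\mathfrak{M}^1_L(\mathbb{R}^+)$ is the set of measures $\rho$ on $[0,\infty)$ with $\rho(\{0\})=0$ and $\int(1\wedge s)\rho(ds)<\infty$. $\Phi_\mu(\rho)$ is the measure with $\Phi_\mu(\rho)(\{0\})=0$ and $\Phi_\mu(\rho)(A)=\int_0^\infty\mu^s(A)\rho(ds)$ for Borel $A\subseteq\mathbb{R}\setminus\{0\}$ (when $\mu$ is supported on $[0,\infty)$, $\Phi_\mu(\rho)$ is a measure on $(0,\infty)$). *)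

theory Defs
  imports "HOL-Probability.Probability" "HOL-Probability.Convolution"
begin

fun conv_pow :: "real measure \<Rightarrow> nat \<Rightarrow> real measure" where
  "conv_pow \<nu> 0 = return borel 0"
| "conv_pow \<nu> (Suc n) = convolution \<nu> (conv_pow \<nu> n)"

definition ID :: "real measure \<Rightarrow> bool" where
  "ID \<mu> \<longleftrightarrow> real_distribution \<mu> \<and>
     (\<forall>n::nat. n \<ge> 1 \<longrightarrow> (\<exists>\<nu>. real_distribution \<nu> \<and> conv_pow \<nu> n = \<mu>))"

definition char_exponent :: "real measure \<Rightarrow> real \<Rightarrow> complex" where
  "char_exponent \<mu> = (THE \<phi>. continuous_on UNIV \<phi> \<and> \<phi> 0 = 0 \<and>
                          (\<forall>t. char \<mu> t = exp (\<phi> t)))"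

definition mu_pow :: "real measure \<Rightarrow> real \<Rightarrow> real measure" where
  "mu_pow \<mu> s = (THE \<nu>. real_distribution \<nu> \<and>
                    (\<forall>t. char \<nu> t = exp (complex_of_real s * char_exponent \<mu> t)))"

definition ML1L :: "real measure set" where
  "ML1L = {\<rho>. sets \<rho> = sets borel \<and> emeasure \<rho> {..0} = 0 \<and>
             (\<integral>\<^sup>+ s. ennreal (min 1 s) \<partial>\<rho>) < \<infinity>}"

definition Phi :: "real measure \<Rightarrow> real measure \<Rightarrow> real measure" where
  "Phi \<mu> \<rho> = measure_of UNIV (sets borel)
                 (\<lambda>A. \<integral>\<^sup>+ s. emeasure (mu_pow \<mu> s) (A - {0}) \<partial>\<rho>)"

end

(* On the half-line everything is read off Laplace transforms. If exp (- psi u) is the Laplace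
transform of mu, then mu^s has transform exp (- s psi u), hence Phi_mu rho integrates
1 - exp (- u x) to the same value as rho integrates 1 - exp (- s psi u). For u = 1 this gives the
integrability of Phi_mu rho. As u varies, psi u covers an interval with left endpoint 0, and by
analytic continuation the integrals of 1 - exp (- s z) for z in an interval determine rho.
Finally, the Dirac measure at 1 is not in the image: otherwise some mu^s with s > 0 would live on
{0, 1}, which for mu^s = mu^(s/2) * mu^(s/2) forces mu^(s/2), and then mu, to be Dirac. *)

theory Submission
  imports Defs "HOL-Complex_Analysis.Complex_Analysis"
begin

section \<open>Convolutions of laws on the half-line\<close>

text \<open>The definitions speak only of characteristic functions and select
  \<open>char_exponent\<close> and \<open>mu_pow\<close> by \<open>THE\<close>, so both must be
  shown to exist before any Laplace transform can be used. The half-line helps here: the n-th roots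
  of mu live there too, their Laplace transforms at 1 tend to 1 as n grows, and this keeps their
  characteristic functions away from 0 at each fixed argument for large n. The powers mu^s then
  arise as weak limits of integer powers of roots. Knowing the characteristic function of mu^s does
  not directly give its Laplace transform; the semigroup law in s does, because a nonnegative
  additive function of s is linear. Two further obstacles concern \<open>Phi\<close>: rho may have
  infinite mass, so uniqueness theorems for finite measures do not apply to it directly, and mu^s
  may have an atom at 0, so integrals against \<open>Phi\<close> are computed only for functions
  vanishing at 0.\<close>

lemma integral_convolution_mult:
  fixes f :: "real \<Rightarrow> 'b::{real_normed_field, second_countable_topology, banach}"
  assumes M: "real_distribution M" and N: "real_distribution N"
    and int: "integrable M f" "integrable N f" and meas[measurable]: "f \<in> borel_measurable borel"
    and mult: "\<And>x y. f (x + y) = f x * f y"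
  shows "(\<integral>x. f x \<partial>convolution M N) = (\<integral>x. f x \<partial>M) * (\<integral>x. f x \<partial>N)"
proof -
  interpret M: real_distribution M by fact
  interpret N: real_distribution N by fact
  interpret pair_prob_space M N ..
  have "integrable (M \<Otimes>\<^sub>M N) (\<lambda>z. f (fst z) * f (snd z))"
    using int by (intro Fubini_integrable) (auto simp: norm_mult)
  note fub = integral_fst'[OF this]
  have "(\<integral>x. f x \<partial>convolution M N) = (\<integral>z. f (fst z) * f (snd z) \<partial>(M \<Otimes>\<^sub>M N))"
    by (simp add: convolution_def integral_distr case_prod_beta mult)
  also have "\<dots> = (\<integral>x. f x \<partial>M) * (\<integral>x. f x \<partial>N)"
    unfolding fub[symmetric] using int by simp
  finally show ?thesis .
qed

lemma real_distribution_convolution: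
  assumes "real_distribution M" "real_distribution N"
  shows "real_distribution (convolution M N)"
proof -
  interpret M: real_distribution M by fact
  interpret N: real_distribution N by fact
  interpret pair_prob_space M N ..
  show ?thesis
    unfolding convolution_def by (intro real_distribution_distr) measurable
qed

lemma char_convolution:
  assumes "real_distribution M" "real_distribution N"
  shows "char (convolution M N) t = char M t * char N t"
proof -
  interpret M: real_distribution M by fact
  interpret N: real_distribution N by fact
  show ?thesis
    unfolding char_def using assms
    by (intro integral_convolution_mult)
       (auto intro!: M.integrable_iexp N.integrable_iexp simp: distrib_left exp_add[symmetric])
qed

lemma real_distribution_return: "real_distribution (return borel (x::real))"
  by (intro real_distribution.intro prob_space_return real_distribution_axioms.intro) auto

lemma char_return: "char (return borel x) t = exp (\<i> * of_real (t * x))"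
  unfolding char_def by (subst integral_return) auto

lemma real_distribution_conv_pow:
  "real_distribution M \<Longrightarrow> real_distribution (conv_pow M n)"
  by (induction n) (auto intro: real_distribution_return real_distribution_convolution)

lemma char_conv_pow:
  "real_distribution M \<Longrightarrow> char (conv_pow M n) t = char M t ^ n"
  by (induction n) (auto simp: char_return char_convolution real_distribution_conv_pow)

text \<open>Both sides have the same characteristic function, which replaces an argument by
  associativity of convolution.\<close>

lemma conv_pow_add:
  "real_distribution M \<Longrightarrow> conv_pow M (m + n) = convolution (conv_pow M m) (conv_pow M n)"
  by (intro Levy_uniqueness ext)
     (auto simp: char_conv_pow char_convolution real_distribution_conv_pow power_add
           intro: real_distribution_convolution)

text \<open>The rectangle \<open>A \<times> B\<close> lies in the preimage of \<open>C\<close> under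
  addition, and its product measure factors.\<close>

lemma emeasure_convolution_ge:
  assumes M: "real_distribution M" and N: "real_distribution N"
    and [measurable]: "A \<in> sets borel" "B \<in> sets borel" "C \<in> sets borel"
    and sub: "\<And>x y. x \<in> A \<Longrightarrow> y \<in> B \<Longrightarrow> x + y \<in> C"
  shows "emeasure M A * emeasure N B \<le> emeasure (convolution M N) C"
proof -
  interpret M: real_distribution M by fact
  interpret N: real_distribution N by fact
  have sets: "{z \<in> space (M \<Otimes>\<^sub>M N). fst z + snd z \<in> C} \<in> sets (M \<Otimes>\<^sub>M N)"
    by measurable
  have "emeasure M A * emeasure N B = emeasure (M \<Otimes>\<^sub>M N) (A \<times> B)"
    by (simp add: N.emeasure_pair_measure_Times)
  also have "\<dots> \<le> emeasure (M \<Otimes>\<^sub>M N) {z \<in> space (M \<Otimes>\<^sub>M N). fst z + snd z \<in> C}"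
    by (rule emeasure_mono[OF _ sets]) (auto simp: sub space_pair_measure)
  also have "\<dots> = emeasure (convolution M N) C"
    by (auto simp: convolution_def emeasure_distr intro!: arg_cong[where f="emeasure _"])
  finally show ?thesis .
qed

text \<open>Since \<open>exp (- x) \<le> 1 / (1 + x)\<close>, the right-hand side is at least
  \<open>2 * x / (1 + x)\<close>; the denominator is at most 2 for x below 1 and at most
  \<open>2 * x\<close> beyond, whence the constant 2. This is the comparison between the weight in
  \<open>ML1L\<close> and the Laplace integrand.\<close>

lemma min_one_le_one_minus_exp:
  fixes x :: real
  assumes "0 \<le> x"
  shows "min 1 x \<le> 2 * (1 - exp (- x))"
proof -
  have "exp (- x) \<le> inverse (1 + x)"
    unfolding exp_minus using assms exp_ge_add_one_self[of x] by (intro le_imp_inverse_le) auto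
  then have "2 * (1 - inverse (1 + x)) \<le> 2 * (1 - exp (- x))" by simp
  moreover have "min 1 x \<le> 2 * (1 - inverse (1 + x))"
    using assms by (auto simp: min_def field_simps mult_left_le)
  ultimately show ?thesis by simp
qed

locale nonneg_distribution = real_distribution +
  assumes AE_nonneg: "AE x in M. 0 \<le> x"

lemma nonneg_distributionI:
  assumes "real_distribution M" and "emeasure M {..<0} = 0"
  shows "nonneg_distribution M"
proof -
  interpret real_distribution M by fact
  have "AE x in M. \<not> x < 0"
    using assms by (subst AE_iff_measurable[OF _ refl]) (auto simp: lessThan_def)
  then show ?thesis
    by unfold_locales (auto simp: not_less)
qed

lemma (in nonneg_distribution) emeasure_neg: "emeasure M {..<0} = 0"
proof -
  have "emeasure M {x \<in> space M. \<not> 0 \<le> x} = 0"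
    using AE_nonneg by (subst (asm) AE_iff_measurable[OF _ refl]) auto
  then show ?thesis by (simp add: lessThan_def not_le)
qed

lemma (in nonneg_distribution) emeasure_nonneg: "emeasure M {0..} = 1"
  using AE_nonneg by (intro emeasure_eq_1_AE) auto

lemma nonneg_distribution_return: "0 \<le> x \<Longrightarrow> nonneg_distribution (return borel x)"
  by (intro nonneg_distributionI real_distribution_return) auto

text \<open>Adding an independent nonnegative variable moves mass to the right: if the first summand
  exceeds x, so does the sum. The bound for \<open>{..x}\<close> follows by complements.\<close>

lemma emeasure_convolution_le:
  assumes M: "real_distribution M" and N: "nonneg_distribution N"
  shows "emeasure (convolution M N) {..x} \<le> emeasure M {..x}"
    and "emeasure M {x<..} \<le> emeasure (convolution M N) {x<..}"
proof -
  interpret M: real_distribution M by fact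
  interpret N: nonneg_distribution N by fact
  interpret C: real_distribution "convolution M N"
    by (intro real_distribution_convolution M N.real_distribution_axioms)
  show ge: "emeasure M {x<..} \<le> emeasure (convolution M N) {x<..}"
    using emeasure_convolution_ge[OF M N.real_distribution_axioms, of "{x<..}" "{0..}" "{x<..}"]
    by (auto simp: N.emeasure_nonneg)
  have *: "{..x} = UNIV - {x<..}" for x :: real by auto
  have "measure (convolution M N) {..x} \<le> measure M {..x}"
    unfolding * using ge M.prob_compl[of "{x<..}"] C.prob_compl[of "{x<..}"]
    by (auto simp: M.emeasure_eq_measure C.emeasure_eq_measure)
  then show "emeasure (convolution M N) {..x} \<le> emeasure M {..x}"
    by (auto simp: M.emeasure_eq_measure C.emeasure_eq_measure)
qed

lemma nonneg_distribution_convolution: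
  assumes "nonneg_distribution M" "nonneg_distribution N"
  shows "nonneg_distribution (convolution M N)"
proof (rule nonneg_distributionI)
  interpret M: nonneg_distribution M by fact
  interpret N: nonneg_distribution N by fact
  show C: "real_distribution (convolution M N)"
    by (intro real_distribution_convolution M.real_distribution_axioms N.real_distribution_axioms)
  interpret C: real_distribution "convolution M N" by fact
  have "1 \<le> emeasure (convolution M N) {0..}"
    using emeasure_convolution_ge[OF M.real_distribution_axioms N.real_distribution_axioms, of "{0..}" "{0..}" "{0..}"]
    by (auto simp: M.emeasure_nonneg N.emeasure_nonneg)
  moreover have "{..<0} = UNIV - {0::real..}" by auto
  ultimately have "measure (convolution M N) {..<0} \<le> 0"
    using C.prob_compl[of "{0..}"] by (auto simp: C.emeasure_eq_measure)
  then show "emeasure (convolution M N) {..<0} = 0"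
    by (simp add: C.emeasure_eq_measure measure_le_0_iff)
qed

lemma nonneg_distribution_conv_pow:
  assumes "nonneg_distribution M"
  shows "nonneg_distribution (conv_pow M n)"
  by (induction n) (auto intro: nonneg_distribution_return nonneg_distribution_convolution assms)

text \<open>A sum of n independent negative terms is negative, so the n-th power of the mass on the
  negative axis is bounded by 0. For n = 0 the power is the Dirac measure at 0 and says nothing
  about \<open>M\<close>.\<close>

lemma nonneg_distribution_conv_pow_root:
  assumes M: "real_distribution M" and "nonneg_distribution (conv_pow M n)" and "1 \<le> n"
  shows "nonneg_distribution M"
proof -
  interpret M: real_distribution M by fact
  interpret nonneg_distribution "conv_pow M n" by fact
  have ge: "emeasure M {..<0} ^ Suc k \<le> emeasure (conv_pow M (Suc k)) {..<0}" for k
  proof (induction k)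
    case 0
    have "emeasure M {..<0} * emeasure (return borel 0) {0::real} \<le> emeasure (conv_pow M 1) {..<0}"
      unfolding One_nat_def conv_pow.simps
      by (rule emeasure_convolution_ge[OF M real_distribution_return]) auto
    then show ?case by simp
  next
    case (Suc k)
    have "emeasure M {..<0} ^ Suc (Suc k) \<le> emeasure M {..<0} * emeasure (conv_pow M (Suc k)) {..<0}"
      using Suc by (simp only: power_Suc[of _ "Suc k"]) (intro mult_left_mono, auto)
    also have "\<dots> \<le> emeasure (conv_pow M (Suc (Suc k))) {..<0}"
      unfolding conv_pow.simps(2)[of M "Suc k"]
      by (rule emeasure_convolution_ge[OF M real_distribution_conv_pow[OF M]]) auto
    finally show ?case .
  qed
  obtain k where "n = Suc k" using \<open>1 \<le> n\<close> by (cases n) auto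
  then have "emeasure M {..<0} ^ Suc k = 0"
    using ge[of k] emeasure_neg by auto
  then show ?thesis
    by (intro nonneg_distributionI M) (auto simp del: power_Suc)
qed

section \<open>Laplace transforms of laws on the half-line\<close>

definition laplace :: "real measure \<Rightarrow> real \<Rightarrow> real"
  where "laplace M u = (\<integral>x. exp (- (u * x)) \<partial>M)"

lemma laplace_return: "laplace (return borel x) u = exp (- (u * x))"
  unfolding laplace_def by (subst integral_return) auto

context nonneg_distribution
begin

lemma integrable_exp: "0 \<le> u \<Longrightarrow> integrable M (\<lambda>x. exp (- (u * x)))"
  using AE_nonneg by (intro integrable_const_bound[of _ 1]) auto

lemma laplace_pos: "0 \<le> u \<Longrightarrow> 0 < laplace M u"
proof -
  assume u: "0 \<le> u"
  have "(\<integral>x. 0 \<partial>M) < laplace M u"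
    unfolding laplace_def
    by (intro integral_less_AE_space integrable_exp u) (auto simp: emeasure_space_1[unfolded space_eq_univ])
  then show ?thesis by simp
qed

lemma laplace_0: "laplace M 0 = 1"
  unfolding laplace_def by (simp add: prob_space[unfolded space_eq_univ])

lemma laplace_le_1: "0 \<le> u \<Longrightarrow> laplace M u \<le> 1"
proof -
  assume u: "0 \<le> u"
  have "laplace M u \<le> (\<integral>x. 1 \<partial>M)"
    unfolding laplace_def using AE_nonneg u
    by (intro integral_mono_AE integrable_exp) auto
  then show ?thesis by (simp add: prob_space[unfolded space_eq_univ])
qed

text \<open>The integrand is at most both 2 and \<open>\<bar>t * x\<bar>\<close>, hence at most
  \<open>(2 + \<bar>t\<bar>) * min 1 x\<close>, and passing to \<open>1 - exp (- x)\<close> doubles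
  the constant. Thus a law whose Laplace transform at 1 is close to 1 has its characteristic
  function close to 1 at any given t.\<close>

lemma norm_char_minus_one_le:
  "norm (char M t - 1) \<le> (4 + 2 * \<bar>t\<bar>) * (1 - laplace M 1)"
proof -
  have int: "integrable M (\<lambda>x. exp (- x))"
    using integrable_exp[of 1] by simp
  have int': "integrable M (\<lambda>x. iexp (t * x) - 1)"
    by (intro Bochner_Integration.integrable_diff integrable_iexp) auto
  have "char M t - 1 = (\<integral>x. iexp (t * x) - 1 \<partial>M)"
    unfolding char_def by (subst Bochner_Integration.integral_diff) (auto intro!: integrable_iexp simp: prob_space[unfolded space_eq_univ])
  also have "norm \<dots> \<le> (\<integral>x. norm (iexp (t * x) - 1) \<partial>M)"
    by (rule integral_norm_bound)
  also have "\<dots> \<le> (\<integral>x. (4 + 2 * \<bar>t\<bar>) * (1 - exp (- x)) \<partial>M)"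
  proof (rule integral_mono_AE)
    show "AE x in M. norm (iexp (t * x) - 1) \<le> (4 + 2 * \<bar>t\<bar>) * (1 - exp (- x))"
      using AE_nonneg
    proof eventually_elim
      case (elim x)
      have "norm (iexp (t * x) - 1) \<le> \<bar>t * x\<bar>"
        using iexp_approx1[of "t * x" 0] by simp
      moreover have "norm (iexp (t * x) - 1) \<le> 2"
        using norm_triangle_ineq4[of "iexp (t * x)" 1] by (simp del: of_real_mult)
      ultimately have "norm (iexp (t * x) - 1) \<le> (2 + \<bar>t\<bar>) * min 1 x"
        using elim by (auto simp: min_def abs_mult distrib_right)
      also have "\<dots> \<le> (2 + \<bar>t\<bar>) * (2 * (1 - exp (- x)))"
        using min_one_le_one_minus_exp[OF elim] by (intro mult_left_mono) auto
      finally show ?case by (simp add: algebra_simps)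
    qed
  qed (use int' int in auto)
  also have "\<dots> = (4 + 2 * \<bar>t\<bar>) * (1 - laplace M 1)"
    unfolding laplace_def using int by (simp add: prob_space[unfolded space_eq_univ])
  finally show ?thesis .
qed

end

lemma laplace_convolution:
  assumes "nonneg_distribution M" "nonneg_distribution N" "0 \<le> u"
  shows "laplace (convolution M N) u = laplace M u * laplace N u"
proof -
  interpret M: nonneg_distribution M by fact
  interpret N: nonneg_distribution N by fact
  show ?thesis
    unfolding laplace_def
    by (intro integral_convolution_mult M.integrable_exp N.integrable_exp assms
         M.real_distribution_axioms N.real_distribution_axioms)
       (auto simp: distrib_left exp_add[symmetric])
qed

lemma laplace_conv_pow:
  "nonneg_distribution M \<Longrightarrow> 0 \<le> u \<Longrightarrow> laplace (conv_pow M n) u = laplace M u ^ n"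
  by (induction n) (auto simp: laplace_return laplace_convolution nonneg_distribution_conv_pow)

section \<open>Infinitely divisible laws on the half-line\<close>

text \<open>The difference is continuous with values in the integer multiples of 2 pi i. These are 2
  pi apart, so on the connected line it is constant.\<close>

lemma continuous_log_unique:
  fixes f g :: "real \<Rightarrow> complex"
  assumes cont: "continuous_on UNIV f" "continuous_on UNIV g"
    and exp: "\<And>t. exp (f t) = exp (g t)" and "f 0 = g 0"
  shows "f = g"
proof -
  define h where "h t = f t - g t" for t
  have "h constant_on UNIV"
  proof (rule continuous_discrete_range_constant)
    show "continuous_on UNIV h"
      unfolding h_def by (intro continuous_intros cont)
    fix x
    have "2 * pi \<le> norm (h y - h x)" if "h y \<noteq> h x" for y
    proof -
      have "exp (h t) = 1" for t
        using exp[of t] by (simp add: h_def exp_diff)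
      then have "exp (h y - h x) = 1"
        by (simp add: exp_diff)
      then obtain n :: int where n: "Re (h y - h x) = 0" "Im (h y - h x) = of_int (2 * n) * pi"
        unfolding exp_eq_1 by auto
      have "n \<noteq> 0"
      proof
        assume "n = 0"
        then have "h y - h x = 0" using n by (intro complex_eqI) auto
        with that show False by simp
      qed
      then have "1 \<le> \<bar>of_int n :: real\<bar>" by linarith
      then have "2 * pi \<le> \<bar>Im (h y - h x)\<bar>"
        unfolding n by (simp add: abs_mult)
      also have "\<dots> \<le> norm (h y - h x)" by (rule abs_Im_le_cmod)
      finally show ?thesis .
    qed
    then show "\<exists>e>0. \<forall>y. y \<in> UNIV \<and> h y \<noteq> h x \<longrightarrow> e \<le> cmod (h y - h x)"
      by (intro exI[of _ "2 * pi"]) auto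
  qed auto
  then obtain c where "\<And>t. h t = c" unfolding constant_on_def by auto
  then show ?thesis using assms(4) unfolding h_def by (metis ext eq_iff_diff_eq_0)
qed

text \<open>This makes the \<open>THE\<close> in \<open>char_exponent\<close> meaningful: a nowhere
  vanishing continuous function on the contractible line has a continuous logarithm.\<close>

lemma char_exponent:
  assumes "real_distribution M" and nz: "\<And>t. char M t \<noteq> 0"
  shows continuous_char_exponent: "continuous_on UNIV (char_exponent M)"
    and char_exponent_0: "char_exponent M 0 = 0"
    and exp_char_exponent: "exp (char_exponent M t) = char M t"
proof -
  interpret real_distribution M by fact
  let ?P = "\<lambda>\<phi>. continuous_on UNIV \<phi> \<and> \<phi> 0 = 0 \<and> (\<forall>t. char M t = exp (\<phi> t))"
  have "continuous_on UNIV (char M)"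
    by (intro continuous_at_imp_continuous_on ballI isCont_char)
  then obtain g where g: "continuous_on UNIV g" "\<And>t. char M t = exp (g t)"
    using continuous_logarithm_on_contractible[of UNIV "char M"] nz by (metis contractible_UNIV iso_tuple_UNIV_I)
  \<comment> \<open>Since \<open>char M 0 = 1\<close>, also \<open>exp (g 0) = 1\<close>, so the
    normalization leaves the exponential unchanged.\<close>
  have "?P (\<lambda>t. g t - g 0)"
    using g char_zero by (auto simp: exp_diff intro!: continuous_intros)
  moreover have "\<phi> = \<psi>" if "?P \<phi>" "?P \<psi>" for \<phi> \<psi>
    using that by (intro continuous_log_unique) auto
  ultimately have "\<exists>!\<phi>. ?P \<phi>" by blast
  from theI'[OF this] have "?P (char_exponent M)"
    unfolding char_exponent_def .
  then show "continuous_on UNIV (char_exponent M)" "char_exponent M 0 = 0" "exp (char_exponent M t) = char M t"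
    by auto
qed

locale nonneg_ID = nonneg_distribution M for M +
  assumes ID: "ID M"
begin

lemma root:
  assumes "1 \<le> n"
  obtains N where "nonneg_distribution N" "conv_pow N n = M"
  using ID assms nonneg_distribution_conv_pow_root nonneg_distribution_axioms
  unfolding ID_def by metis

text \<open>An n-th root \<open>N\<close> satisfies
  \<open>laplace N 1 = root n (laplace M 1)\<close>, which tends to 1. Hence for large n the value
  \<open>char N t\<close> lies within distance 1 of 1, and \<open>char M t\<close> is its n-th
  power. Laplace transforms are used because roots of positive reals involve no choice of
  branch.\<close>

lemma char_nonzero: "char M t \<noteq> 0"
proof -
  have "(\<lambda>n. (4 + 2 * \<bar>t\<bar>) * (1 - root n (laplace M 1))) \<longlonglongrightarrow> (4 + 2 * \<bar>t\<bar>) * (1 - 1)"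
    by (intro tendsto_intros LIMSEQ_root_const laplace_pos) auto
  then have "\<forall>\<^sub>F n in sequentially. (4 + 2 * \<bar>t\<bar>) * (1 - root n (laplace M 1)) < 1"
    by (rule order_tendstoD) auto
  with eventually_ge_at_top[of 1] have "\<forall>\<^sub>F n in sequentially. 1 \<le> n \<and> (4 + 2 * \<bar>t\<bar>) * (1 - root n (laplace M 1)) < 1"
    by eventually_elim auto
  then obtain n where n: "1 \<le> n" "(4 + 2 * \<bar>t\<bar>) * (1 - root n (laplace M 1)) < 1"
    by (auto simp: eventually_sequentially)
  obtain N where N: "nonneg_distribution N" "conv_pow N n = M"
    using root n(1) .
  interpret N: nonneg_distribution N by fact
  have "laplace M 1 = laplace N 1 ^ n"
    using laplace_conv_pow[OF N(1), of 1 n] N(2) by simp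
  then have "root n (laplace M 1) = laplace N 1"
    using n(1) N.laplace_pos[of 1] by (simp add: real_root_power_cancel)
  then have "norm (char N t - 1) < 1"
    using N.norm_char_minus_one_le[of t] n(2) by simp
  then have "char N t \<noteq> 0" by auto
  then show ?thesis
    using char_conv_pow[OF N.real_distribution_axioms, of n t] N(2) by simp
qed

lemmas cont_exponent = continuous_char_exponent[OF real_distribution_axioms char_nonzero]
lemmas exponent_0 = char_exponent_0[OF real_distribution_axioms char_nonzero]
lemmas exp_exponent = exp_char_exponent[OF real_distribution_axioms char_nonzero]

text \<open>Taking n-th roots of \<open>char M\<close> pointwise leaves a root of unity undetermined
  for each t. Continuity of the exponent and its value at 0 remove this ambiguity.\<close>

lemma char_root:
  assumes N: "real_distribution N" and pow: "conv_pow N n = M" and "1 \<le> n"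
  shows "char N t = exp (char_exponent M t / of_nat n)"
proof -
  have pow': "char M t = char N t ^ n" for t
    using char_conv_pow[OF N, of n t] pow by simp
  then have nz: "char N t \<noteq> 0" for t
    using char_nonzero[of t] \<open>1 \<le> n\<close> by auto
  have "(\<lambda>t. of_nat n * char_exponent N t) = char_exponent M"
    using continuous_char_exponent[OF N nz] char_exponent_0[OF N nz] exp_char_exponent[OF N nz]
    by (intro continuous_log_unique continuous_intros cont_exponent)
       (auto simp: exponent_0 exp_exponent exp_of_nat_mult pow')
  then have "char_exponent M t / of_nat n = char_exponent N t"
    using \<open>1 \<le> n\<close> by (auto simp: fun_eq_iff field_simps)
  then show ?thesis
    using exp_char_exponent[OF N nz] by simp
qed

end

section \<open>Convolution powers with real exponent\<close>

text \<open>Nonnegativity makes f monotone, so between consecutive integers it stays within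
  \<open>f 1\<close> of the linear function. Applying this bound at \<open>n * s\<close> multiplies
  the error at s by n, which forces that error to be 0.\<close>

lemma nonneg_additive_imp_linear:
  fixes f :: "real \<Rightarrow> real"
  assumes add: "\<And>s t. 0 \<le> s \<Longrightarrow> 0 \<le> t \<Longrightarrow> f (s + t) = f s + f t"
    and nonneg: "\<And>s. 0 \<le> s \<Longrightarrow> 0 \<le> f s" and s: "0 \<le> s"
  shows "f s = s * f 1"
proof -
  have "f 0 = 0" using add[of 0 0] by simp
  then have mult: "f (real n * x) = real n * f x" if "0 \<le> x" for n x
    using that by (induction n) (auto simp: distrib_right add)
  have mono: "f x \<le> f y" if "0 \<le> x" "x \<le> y" for x y
    using add[of x "y - x"] nonneg[of "y - x"] that by simp
  have near: "\<bar>f x - x * f 1\<bar> \<le> f 1" if x: "0 \<le> x" for x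
  proof -
    define k where "k = nat \<lfloor>x\<rfloor>"
    have k: "real k \<le> x" "x \<le> real (Suc k)"
      using x unfolding k_def by (auto simp: of_nat_nat) linarith+
    have "real k * f 1 \<le> f x" "f x \<le> real (Suc k) * f 1"
      using mono[of "real k" x] mono[OF x k(2)] k mult[of 1 k] mult[of 1 "Suc k"] by auto
    moreover have "real k * f 1 \<le> x * f 1" "x * f 1 \<le> real (Suc k) * f 1"
      using k nonneg[of 1] by (auto intro!: mult_right_mono)
    ultimately show ?thesis by (auto simp: distrib_right)
  qed
  have "real n * \<bar>f s - s * f 1\<bar> \<le> f 1" for n
  proof -
    have "real n * \<bar>f s - s * f 1\<bar> = \<bar>f (real n * s) - (real n * s) * f 1\<bar>"
      using mult[OF s, of n] by (simp add: abs_mult right_diff_distrib[symmetric] mult.assoc)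
    also have "\<dots> \<le> f 1" using s by (intro near) auto
    finally show ?thesis .
  qed
  then have "\<not> 0 < \<bar>f s - s * f 1\<bar>"
    using reals_Archimedean3 by (metis not_less)
  then show ?thesis by simp
qed

lemma nonneg_distribution_weak_limit:
  assumes V: "\<And>n::nat. nonneg_distribution (V n)" and N: "real_distribution N" and lim: "weak_conv_m V N"
  shows "nonneg_distribution N"
proof -
  interpret N: real_distribution N by fact
  \<comment> \<open>A bounded continuous substitute for the indicator of the negative axis: it is
    positive exactly there.\<close>
  define f :: "real \<Rightarrow> real" where "f x = min 1 (max 0 (- x))" for x
  have f: "0 \<le> f x" "f x \<le> 1" "continuous_on UNIV f" for x
    unfolding f_def by (auto intro!: continuous_intros)
  have [measurable]: "f \<in> borel_measurable borel"
    using f(3) by (rule borel_measurable_continuous_onI)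
  have "(\<lambda>n. integral\<^sup>L (V n) f) \<longlonglongrightarrow> integral\<^sup>L N f"
    using V N lim f
    by (intro weak_conv_imp_integral_bdd_continuous_conv[where B=1])
       (auto simp: nonneg_distribution_def continuous_on_eq_continuous_at)
  moreover have "integral\<^sup>L (V n) f = 0" for n
  proof -
    interpret nonneg_distribution "V n" by fact
    have "integral\<^sup>L (V n) f = (\<integral>x. 0 \<partial>V n)"
      using AE_nonneg by (intro integral_cong_AE) (auto simp: f_def)
    then show ?thesis by simp
  qed
  ultimately have "integral\<^sup>L N f = 0"
    by (simp add: LIMSEQ_const_iff)
  moreover have "integrable N f"
    using f by (intro N.integrable_const_bound[of _ 1]) auto
  ultimately have "AE x in N. f x = 0"
    using f by (subst (asm) integral_nonneg_eq_0_iff_AE) auto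
  then have "AE x in N. 0 \<le> x"
    by (rule AE_mp) (auto simp: f_def min_def max_def split: if_splits)
  then show ?thesis
    by (intro nonneg_distribution.intro N nonneg_distribution_axioms.intro)
qed

context nonneg_ID
begin

text \<open>Integer powers of the roots have exponents tending to s, so their characteristic
  functions converge to the required one. That this limit belongs to a law is obtained from
  tightness: each approximant is a convolution factor of one fixed integer power of
  \<open>M\<close>.\<close>

lemma mu_pow_exists:
  assumes s: "0 \<le> s"
  shows "\<exists>N. nonneg_distribution N \<and> (\<forall>t. char N t = exp (complex_of_real s * char_exponent M t))"
proof -
  have "\<forall>n. \<exists>N. nonneg_distribution N \<and> conv_pow N (Suc n) = M"
    using root by (metis le_add1 plus_1_eq_Suc)
  then obtain R where R: "\<And>n. nonneg_distribution (R n)" "\<And>n. conv_pow (R n) (Suc n) = M"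
    by metis
  have R': "real_distribution (R n)" for n
    using R(1)[of n] by (simp add: nonneg_distribution_def)
  \<comment> \<open>The root \<open>R n\<close> has order \<open>Suc n\<close>, so its
    \<open>m n\<close>-th power has exponent \<open>m n / Suc n\<close>, the best such approximation
    to s from below.\<close>
  define m where "m n = nat \<lfloor>real (Suc n) * s\<rfloor>" for n
  define V where "V n = conv_pow (R n) (m n)" for n
  have V: "nonneg_distribution (V n)" for n
    unfolding V_def by (intro nonneg_distribution_conv_pow R)
  then have V': "real_distribution (V n)" for n
    by (simp add: nonneg_distribution_def)
  have charR: "char (R n) t = exp (char_exponent M t / of_nat (Suc n))" for n t
    by (rule char_root[OF R' R(2)]) simp
  have m: "real (m n) \<le> real (Suc n) * s" "real (Suc n) * s \<le> real (m n) + 1" for n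
    using s unfolding m_def by (auto simp: of_nat_nat)
  have charV: "char (V n) t = exp (complex_of_real (real (m n) / real (Suc n)) * char_exponent M t)" for n t
    unfolding V_def char_conv_pow[OF R'] charR exp_of_nat_mult[symmetric] by simp
  have mlim: "(\<lambda>n. real (m n) / real (Suc n)) \<longlonglongrightarrow> s"
  proof (rule tendsto_sandwich)
    have "s - 1 / real (Suc n) = (real (Suc n) * s - 1) / real (Suc n)" for n
      by (simp add: diff_divide_distrib del: of_nat_Suc)
    also have "\<dots> n \<le> real (m n) / real (Suc n)" for n
      using m(2)[of n] by (intro divide_right_mono) auto
    finally show "\<forall>\<^sub>F n in sequentially. s - 1 / real (Suc n) \<le> real (m n) / real (Suc n)"
      by (intro always_eventually allI)
    have "real (m n) / real (Suc n) \<le> s" for n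
      using m(1)[of n] by (subst pos_divide_le_eq) (auto simp: mult.commute)
    then show "\<forall>\<^sub>F n in sequentially. real (m n) / real (Suc n) \<le> s"
      by (intro always_eventually allI)
    show "(\<lambda>n. s - 1 / real (Suc n)) \<longlonglongrightarrow> s"
      using tendsto_diff[OF tendsto_const[of s] LIMSEQ_inverse_real_of_nat] by (simp add: inverse_eq_divide)
  qed simp
  \<comment> \<open>An integer above s, chosen independently of n, so that the tails of
    \<open>conv_pow M K\<close> dominate all approximants at once.\<close>
  define K where "K = nat \<lceil>s\<rceil>"
  have tail: "emeasure (V n) {b<..} \<le> emeasure (conv_pow M K) {b<..}" for n b
  proof -
    have "s \<le> real K" by (simp add: K_def of_nat_ceiling)
    then have "real (m n) \<le> real (Suc n) * real K"
      using m(1)[of n] mult_left_mono[of s "real K" "real (Suc n)"] by linarith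
    then have "real (m n) \<le> real (Suc n * K)" by (simp only: of_nat_mult)
    then have le: "m n \<le> Suc n * K" by (simp only: of_nat_le_iff)
    have "conv_pow M K = conv_pow (R n) (Suc n * K)"
      using R(2)[of n, symmetric] real_distribution_axioms
      by (intro Levy_uniqueness ext real_distribution_conv_pow R')
         (simp_all only: char_conv_pow R' power_mult)
    also have "\<dots> = convolution (V n) (conv_pow (R n) (Suc n * K - m n))"
      unfolding V_def using conv_pow_add[OF R', of n "m n" "Suc n * K - m n"] le by simp
    finally show ?thesis
      using emeasure_convolution_le(2)[OF V' nonneg_distribution_conv_pow[OF R(1)]] by simp
  qed
  have "tight V"
    unfolding tight_def
  proof (intro conjI allI impI V')
    fix e :: real assume "0 < e"
    interpret C: real_distribution "conv_pow M K"
      by (intro real_distribution_conv_pow real_distribution_axioms)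
    have "\<forall>\<^sub>F b in at_top. 1 - e < cdf (conv_pow M K) b"
      using C.cdf_lim_at_top_prob \<open>0 < e\<close> by (intro order_tendstoD) auto
    with eventually_ge_at_top[of 0] have "\<forall>\<^sub>F b in at_top. 0 \<le> b \<and> 1 - e < cdf (conv_pow M K) b"
      by eventually_elim auto
    then obtain b where b: "0 \<le> b" "1 - e < measure (conv_pow M K) {..b}"
      unfolding cdf_def by (auto simp: eventually_at_top_linorder)
    \<comment> \<open>Tightness is phrased with intervals open on the left; a negative left endpoint
      keeps a possible atom at 0 inside.\<close>
    have "1 - e < measure (V n) {-1<..b}" for n
    proof -
      interpret V: nonneg_distribution "V n" by (rule V)
      have "{b<..} = UNIV - {..b}" by auto
      then have "measure (conv_pow M K) {b<..} < e"
        using b C.prob_compl[of "{..b}"] by auto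
      then have "measure (V n) {b<..} < e"
        using tail[of n b] by (auto simp: V.emeasure_eq_measure C.emeasure_eq_measure)
      moreover have "{..b} = UNIV - {b<..}" by auto
      ultimately have "1 - e < measure (V n) {..b}"
        using V.prob_compl[of "{b<..}"] by auto
      also have "measure (V n) {..b} = measure (V n) {-1<..b}"
        using V.AE_nonneg by (intro V.finite_measure_eq_AE) auto
      finally show ?thesis .
    qed
    then show "\<exists>a b. a < b \<and> (\<forall>n. 1 - e < measure (V n) {a<..b})"
      using b(1) by (intro exI[of _ "-1"] exI[of _ b]) auto
  qed
  from tight_imp_convergent_subsubsequence[OF this strict_mono_id]
  obtain r N where r: "strict_mono r" and N: "real_distribution N" "weak_conv_m (\<lambda>n. V (r n)) N"
    by (auto simp: comp_def)
  have "char N t = exp (complex_of_real s * char_exponent M t)" for t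
  proof (rule LIMSEQ_unique)
    show "(\<lambda>n. char (V (r n)) t) \<longlonglongrightarrow> char N t"
      by (intro levy_continuity1 V' N)
    show "(\<lambda>n. char (V (r n)) t) \<longlonglongrightarrow> exp (complex_of_real s * char_exponent M t)"
      unfolding charV
      by (intro tendsto_intros LIMSEQ_subseq_LIMSEQ[OF mlim r, unfolded comp_def])
  qed
  moreover have "nonneg_distribution N"
    using nonneg_distribution_weak_limit[OF V N] .
  ultimately show ?thesis by blast
qed

lemma
  assumes "0 \<le> s"
  shows nonneg_distribution_mu_pow: "nonneg_distribution (mu_pow M s)"
    and char_mu_pow: "char (mu_pow M s) t = exp (complex_of_real s * char_exponent M t)"
proof -
  let ?P = "\<lambda>N. real_distribution N \<and> (\<forall>t. char N t = exp (complex_of_real s * char_exponent M t))"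
  obtain N where N: "nonneg_distribution N" "?P N"
    using mu_pow_exists[OF assms] by (auto simp: nonneg_distribution_def)
  have "mu_pow M s = N"
    unfolding mu_pow_def
  proof (rule the_equality)
    fix N' assume "?P N'"
    then show "N' = N" using N by (intro Levy_uniqueness) (auto intro!: ext)
  qed (rule N)
  then show "nonneg_distribution (mu_pow M s)" "char (mu_pow M s) t = exp (complex_of_real s * char_exponent M t)"
    using N by auto
qed

lemma real_distribution_mu_pow: "0 \<le> s \<Longrightarrow> real_distribution (mu_pow M s)"
  using nonneg_distribution_mu_pow by (simp add: nonneg_distribution_def)

lemma mu_pow_1: "mu_pow M 1 = M"
  by (intro Levy_uniqueness ext real_distribution_mu_pow real_distribution_axioms)
     (auto simp: char_mu_pow exp_exponent)

lemma mu_pow_add: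
  "0 \<le> s \<Longrightarrow> 0 \<le> t \<Longrightarrow> mu_pow M (s + t) = convolution (mu_pow M s) (mu_pow M t)"
  by (intro Levy_uniqueness ext real_distribution_mu_pow real_distribution_convolution)
     (auto simp: char_mu_pow char_convolution real_distribution_mu_pow distrib_right exp_add)

definition laplace_exponent :: "real \<Rightarrow> real"
  where "laplace_exponent u = - ln (laplace M u)"

text \<open>For fixed u, minus the logarithm of the transform is additive in s by the semigroup law
  and nonnegative on the half-line, hence linear. Its slope is read off at s = 1, where
  \<open>mu_pow M 1 = M\<close>.\<close>

lemma laplace_mu_pow:
  assumes "0 \<le> u" "0 \<le> s"
  shows "laplace (mu_pow M s) u = exp (- (s * laplace_exponent u))"
proof -
  have pos: "0 < laplace (mu_pow M s) u" and le: "laplace (mu_pow M s) u \<le> 1" if "0 \<le> s" for s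
    using nonneg_distribution.laplace_pos nonneg_distribution.laplace_le_1
      nonneg_distribution_mu_pow[OF that] assms(1) by auto
  have "- ln (laplace (mu_pow M s) u) = s * - ln (laplace (mu_pow M 1) u)"
    using assms pos le
    by (intro nonneg_additive_imp_linear)
       (auto simp: mu_pow_add laplace_convolution nonneg_distribution_mu_pow ln_mult_pos)
  then have "ln (laplace (mu_pow M s) u) = - (s * laplace_exponent u)"
    by (simp add: laplace_exponent_def mu_pow_1)
  then show ?thesis
    using pos[OF assms(2)] by (metis exp_ln)
qed

lemma laplace_exponent_nonneg: "0 \<le> u \<Longrightarrow> 0 \<le> laplace_exponent u"
  unfolding laplace_exponent_def using laplace_le_1[of u] laplace_pos[of u] by simp

lemma laplace_exponent_0: "laplace_exponent 0 = 0"
  by (simp add: laplace_exponent_def laplace_0)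

lemma continuous_on_laplace_exponent: "continuous_on {0..} laplace_exponent"
proof -
  have "continuous_on {0..} (laplace M)"
    unfolding continuous_on_sequentially comp_def laplace_def
  proof safe
    fix X :: "nat \<Rightarrow> real" and u assume X: "\<forall>n. X n \<in> {0..}" "X \<longlonglongrightarrow> u"
    show "(\<lambda>n. \<integral>x. exp (- (X n * x)) \<partial>M) \<longlonglongrightarrow> (\<integral>x. exp (- (u * x)) \<partial>M)"
    proof (rule integral_dominated_convergence[where w="\<lambda>_. 1"])
      show "AE x in M. norm (exp (- (X n * x))) \<le> 1" for n
        using AE_nonneg by eventually_elim (use X(1) in auto)
    qed (auto intro!: tendsto_intros X)
  qed
  then show ?thesis
    unfolding laplace_exponent_def
    by (intro continuous_intros) (auto dest: laplace_pos)
qed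

end

section \<open>The transform of Levy measures\<close>

lemma ML1L_D:
  assumes "\<rho> \<in> ML1L"
  shows "sets \<rho> = sets borel" "space \<rho> = UNIV" "AE s in \<rho>. 0 < s"
proof -
  show *: "sets \<rho> = sets borel" using assms by (simp add: ML1L_def)
  then show "space \<rho> = UNIV" by (simp add: sets_eq_imp_space_eq[of \<rho> borel])
  then show "AE s in \<rho>. 0 < s"
    using assms * by (subst AE_iff_measurable[OF _ refl]) (auto simp: ML1L_def not_less atMost_def)
qed

lemma nn_integral_one_minus_exp_finite:
  assumes "\<rho> \<in> ML1L" and c: "0 \<le> c"
  shows "(\<integral>\<^sup>+s. ennreal (1 - exp (- (s * c))) \<partial>\<rho>) < \<infinity>"
proof -
  note [measurable_cong] = ML1L_D(1)[OF assms(1)]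
  have "ennreal (1 - exp (- (s * c))) \<le> ennreal (max 1 c) * ennreal (min 1 s)" for s
  proof (cases "0 \<le> s")
    case True
    have "1 - exp (- (s * c)) \<le> min 1 (s * c)"
      using exp_ge_add_one_self[of "- (s * c)"] by auto
    also have "\<dots> \<le> max 1 c * min 1 s"
    proof (cases "s \<le> 1")
      case True
      have "c * s \<le> max 1 c * s" using \<open>0 \<le> s\<close> by (intro mult_right_mono) auto
      with True show ?thesis by (simp add: mult.commute min.coboundedI2)
    qed auto
    finally show ?thesis by (subst ennreal_mult'[symmetric]) (auto intro: ennreal_leI)
  next
    \<comment> \<open>For negative s the difference is nonpositive and \<open>ennreal\<close>
      truncates it to 0.\<close>
    case False
    then have "s * c \<le> 0" using c by (simp add: mult_nonpos_nonneg)
    then have "1 - exp (- (s * c)) \<le> 0" by simp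
    then show ?thesis by (simp add: ennreal_neg)
  qed
  then have "(\<integral>\<^sup>+s. ennreal (1 - exp (- (s * c))) \<partial>\<rho>) \<le> (\<integral>\<^sup>+s. ennreal (max 1 c) * ennreal (min 1 s) \<partial>\<rho>)"
    by (intro nn_integral_mono)
  also have "\<dots> = ennreal (max 1 c) * (\<integral>\<^sup>+s. ennreal (min 1 s) \<partial>\<rho>)"
    by (intro nn_integral_cmult) measurable
  also have "\<dots> < \<infinity>"
    using assms(1) by (auto simp: ML1L_def ennreal_mult_less_top)
  finally show ?thesis .
qed

lemma (in nonneg_distribution) nn_integral_one_minus_exp:
  assumes "0 \<le> u"
  shows "(\<integral>\<^sup>+x. ennreal (1 - exp (- (u * x))) \<partial>M) = ennreal (1 - laplace M u)"
proof -
  have "(\<integral>\<^sup>+x. ennreal (1 - exp (- (u * x))) \<partial>M) = ennreal (\<integral>x. 1 - exp (- (u * x)) \<partial>M)"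
  proof (rule nn_integral_eq_integral)
    show "AE x in M. 0 \<le> 1 - exp (- (u * x))"
      using AE_nonneg by eventually_elim (use assms in auto)
  qed (intro Bochner_Integration.integrable_diff integrable_exp assms integrable_const)
  also have "(\<integral>x. 1 - exp (- (u * x)) \<partial>M) = 1 - laplace M u"
    unfolding laplace_def using integrable_exp[OF assms] by (simp add: prob_space[unfolded space_eq_univ])
  finally show ?thesis .
qed

section \<open>Mixtures of the powers mu^s\<close>

context nonneg_ID
begin

text \<open>At a negative exponent mu^s is in general an unspecified THE, hence the truncation.\<close>

definition kernel :: "real \<Rightarrow> real measure"
  where "kernel s = mu_pow M (max 0 s)"

lemma nonneg_distribution_kernel: "nonneg_distribution (kernel s)"
  unfolding kernel_def by (intro nonneg_distribution_mu_pow) simp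

lemma real_distribution_kernel: "real_distribution (kernel s)"
  using nonneg_distribution_kernel by (simp add: nonneg_distribution_def)

lemma sets_kernel: "sets (kernel s) = sets borel"
  using real_distribution_kernel by (simp add: real_distribution_def real_distribution_axioms_def)

text \<open>Convolving with a law on the half-line shifts mass to the right, so each distribution
  function is monotone in the exponent, hence measurable in it.\<close>

lemma kernel_measurable[measurable]: "kernel \<in> measurable borel (subprob_algebra borel)"
proof (rule measurable_subprob_algebra_generated)
  show "sets borel = sigma_sets UNIV (range (\<lambda>x::real. {..x}))"
    by (simp add: borel_eq_atMost)
  show "Int_stable (range (\<lambda>x::real. {..x}))"
    by (auto simp: Int_stable_def)
  fix s
  interpret K: real_distribution "kernel s" by (rule real_distribution_kernel)
  show "subprob_space (kernel s)" by unfold_locales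
  show "sets (kernel s) = sets borel" by (rule sets_kernel)
next
  have [simp]: "emeasure (kernel s) UNIV = 1" for s
  proof -
    interpret K: real_distribution "kernel s" by (rule real_distribution_kernel)
    show ?thesis using K.emeasure_space_1 by simp
  qed
  show "(\<lambda>s. emeasure (kernel s) UNIV) \<in> borel_measurable borel"
    by simp
  fix A :: "real set" assume "A \<in> range (\<lambda>x. {..x})"
  then obtain x where A: "A = {..x}" by auto
  have le: "emeasure (kernel t) {..x} \<le> emeasure (kernel s) {..x}" if "s \<le> t" for s t
  proof -
    have "kernel t = mu_pow M (max 0 s + (max 0 t - max 0 s))"
      by (simp add: kernel_def)
    also have "\<dots> = convolution (mu_pow M (max 0 s)) (mu_pow M (max 0 t - max 0 s))"
      using that by (intro mu_pow_add) auto
    finally show ?thesis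
      using that unfolding kernel_def
      by (auto intro!: emeasure_convolution_le real_distribution_mu_pow nonneg_distribution_mu_pow)
  qed
  have "mono (\<lambda>s. - measure (kernel s) {..x})"
  proof (rule monoI)
    fix s t :: real assume "s \<le> t"
    interpret s: real_distribution "kernel s" by (rule real_distribution_kernel)
    interpret t: real_distribution "kernel t" by (rule real_distribution_kernel)
    show "- measure (kernel s) {..x} \<le> - measure (kernel t) {..x}"
      using le[OF \<open>s \<le> t\<close>] by (simp add: s.emeasure_eq_measure t.emeasure_eq_measure)
  qed
  then have "(\<lambda>s. - (- measure (kernel s) {..x})) \<in> borel_measurable borel"
    by (intro borel_measurable_uminus borel_measurable_mono)
  then have "(\<lambda>s. ennreal (measure (kernel s) {..x})) \<in> borel_measurable borel"
    by simp
  also have "(\<lambda>s. ennreal (measure (kernel s) {..x})) = (\<lambda>s. emeasure (kernel s) {..x})"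
  proof
    fix s
    interpret K: real_distribution "kernel s" by (rule real_distribution_kernel)
    show "ennreal (measure (kernel s) {..x}) = emeasure (kernel s) {..x}"
      by (simp add: K.emeasure_eq_measure)
  qed
  finally show "(\<lambda>s. emeasure (kernel s) A) \<in> borel_measurable borel"
    by (simp add: A)
qed auto

text \<open>\<open>measure_of\<close> returns the null measure unless its set function is countably
  additive. Exhibiting that function as the \<open>emeasure\<close> of a genuine measure rules this
  out; the indicator deletes the atom at 0, which can have infinite mass in the bind.\<close>

lemma Phi_eq:
  assumes "\<rho> \<in> ML1L"
  shows "Phi M \<rho> = density (\<rho> \<bind> kernel) (indicator (- {0}))"
proof -
  note [measurable_cong] = ML1L_D(1)[OF assms]
  have [measurable_cong, simp]: "sets (\<rho> \<bind> kernel) = sets borel"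
    by (rule sets_bind) (auto simp: sets_kernel ML1L_D[OF assms])
  let ?D = "density (\<rho> \<bind> kernel) (indicator (- {0}))"
  have em: "(\<integral>\<^sup>+ s. emeasure (mu_pow M s) (A - {0}) \<partial>\<rho>) = emeasure ?D A"
    if [measurable]: "A \<in> sets borel" for A
  proof -
    have "(\<integral>\<^sup>+ s. emeasure (mu_pow M s) (A - {0}) \<partial>\<rho>) = (\<integral>\<^sup>+ s. emeasure (kernel s) (A - {0}) \<partial>\<rho>)"
      using ML1L_D(3)[OF assms] by (intro nn_integral_cong_AE) (auto simp: kernel_def)
    also have "\<dots> = emeasure (\<rho> \<bind> kernel) (A - {0})"
      by (rule emeasure_bind[symmetric, where N=borel]) (auto simp: ML1L_D[OF assms])
    also have "\<dots> = (\<integral>\<^sup>+x. indicator (A - {0}) x \<partial>(\<rho> \<bind> kernel))"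
      by simp
    also have "\<dots> = (\<integral>\<^sup>+x. indicator (- {0}) x * indicator A x \<partial>(\<rho> \<bind> kernel))"
      by (intro nn_integral_cong) (auto split: split_indicator)
    also have "\<dots> = emeasure ?D A"
      by (rule emeasure_density[symmetric]) auto
    finally show ?thesis .
  qed
  have "Phi M \<rho> = measure_of UNIV (sets borel) (emeasure ?D)"
    unfolding Phi_def by (rule measure_of_eq) (auto simp: em sets.sigma_sets_eq[of borel, simplified])
  also have "\<dots> = measure_of (space ?D) (sets ?D) (emeasure ?D)"
    by (simp add: sets_eq_imp_space_eq[of "\<rho> \<bind> kernel" borel])
  finally show ?thesis
    by (simp only: measure_of_of_measure)
qed

lemma sets_Phi: "\<rho> \<in> ML1L \<Longrightarrow> sets (Phi M \<rho>) = sets borel"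
  unfolding Phi_eq by (simp, rule sets_bind) (auto simp: sets_kernel ML1L_D)

text \<open>A function vanishing at 0 does not see the deleted atom. The integrands
  \<open>1 - exp (- (u * x))\<close> are of this kind.\<close>

lemma nn_integral_Phi:
  assumes "\<rho> \<in> ML1L" and [measurable]: "f \<in> borel_measurable borel" and "f 0 = 0"
  shows "(\<integral>\<^sup>+x. f x \<partial>Phi M \<rho>) = (\<integral>\<^sup>+s. (\<integral>\<^sup>+x. f x \<partial>kernel s) \<partial>\<rho>)"
proof -
  note [measurable_cong] = ML1L_D(1)[OF assms(1)]
  have [measurable_cong]: "sets (\<rho> \<bind> kernel) = sets borel"
    by (rule sets_bind) (auto simp: sets_kernel ML1L_D[OF assms(1)])
  have "(\<integral>\<^sup>+x. f x \<partial>Phi M \<rho>) = (\<integral>\<^sup>+x. indicator (- {0}) x * f x \<partial>(\<rho> \<bind> kernel))"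
    unfolding Phi_eq[OF assms(1)] by (intro nn_integral_density) measurable
  also have "\<dots> = (\<integral>\<^sup>+x. f x \<partial>(\<rho> \<bind> kernel))"
    using assms(3) by (intro nn_integral_cong) (auto split: split_indicator)
  also have "\<dots> = (\<integral>\<^sup>+s. (\<integral>\<^sup>+x. f x \<partial>kernel s) \<partial>\<rho>)"
    by (rule nn_integral_bind[where B=borel]) measurable
  finally show ?thesis .
qed

lemma emeasure_Phi:
  assumes "\<rho> \<in> ML1L" and [measurable]: "A \<in> sets borel" and "0 \<notin> A"
  shows "emeasure (Phi M \<rho>) A = (\<integral>\<^sup>+s. emeasure (kernel s) A \<partial>\<rho>)"
  using nn_integral_Phi[OF assms(1), of "indicator A"] assms(2,3)
  by (simp add: sets_Phi assms(1) sets_kernel)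

lemma nn_integral_Phi_one_minus_exp:
  assumes "\<rho> \<in> ML1L" and u: "0 \<le> u"
  shows "(\<integral>\<^sup>+x. ennreal (1 - exp (- (u * x))) \<partial>Phi M \<rho>) =
    (\<integral>\<^sup>+s. ennreal (1 - exp (- (s * laplace_exponent u))) \<partial>\<rho>)"
proof -
  have "(\<integral>\<^sup>+x. ennreal (1 - exp (- (u * x))) \<partial>Phi M \<rho>) =
    (\<integral>\<^sup>+s. (\<integral>\<^sup>+x. ennreal (1 - exp (- (u * x))) \<partial>kernel s) \<partial>\<rho>)"
    by (rule nn_integral_Phi[OF assms(1)]) auto
  also have "\<dots> = (\<integral>\<^sup>+s. ennreal (1 - exp (- (s * laplace_exponent u))) \<partial>\<rho>)"
    using ML1L_D(3)[OF assms(1)]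
    by (intro nn_integral_cong_AE)
       (auto simp: nonneg_distribution.nn_integral_one_minus_exp[OF nonneg_distribution_mu_pow, OF _ u]
         kernel_def laplace_mu_pow u)
  finally show ?thesis .
qed

lemma Phi_in_ML1L:
  assumes "\<rho> \<in> ML1L"
  shows "Phi M \<rho> \<in> ML1L"
proof -
  note [measurable_cong] = sets_Phi[OF assms]
  have z: "emeasure (Phi M \<rho>) {0} = 0"
    unfolding Phi_eq[OF assms]
    by (subst emeasure_density)
       (auto intro!: nn_integral_zero' simp: sets_bind[of _ _ borel] sets_kernel ML1L_D[OF assms] split: split_indicator)
  have "emeasure (Phi M \<rho>) {..<0} = 0"
    using nonneg_distribution.emeasure_neg[OF nonneg_distribution_kernel]
    by (simp add: emeasure_Phi assms)
  moreover have "{..0} = {..<0} \<union> {0::real}" by auto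
  ultimately have 1: "emeasure (Phi M \<rho>) {..0} = 0"
    using z emeasure_subadditive[of "{..<0}" "Phi M \<rho>" "{0}"] by (simp add: sets_Phi assms)
  have "(\<integral>\<^sup>+ x. ennreal (min 1 x) \<partial>Phi M \<rho>) \<le> (\<integral>\<^sup>+ x. 2 * ennreal (1 - exp (- (1 * x))) \<partial>Phi M \<rho>)"
  proof (rule nn_integral_mono)
    fix x :: real
    show "ennreal (min 1 x) \<le> 2 * ennreal (1 - exp (- (1 * x)))"
    proof (cases "0 \<le> x")
      case True
      have "ennreal (min 1 x) \<le> ennreal (2 * (1 - exp (- x)))"
        by (intro ennreal_leI min_one_le_one_minus_exp True)
      also have "\<dots> = 2 * ennreal (1 - exp (- x))"
        by (subst ennreal_mult') auto
      finally show ?thesis by simp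
    qed (simp add: ennreal_neg)
  qed
  also have "\<dots> = 2 * (\<integral>\<^sup>+ x. ennreal (1 - exp (- (1 * x))) \<partial>Phi M \<rho>)"
    by (intro nn_integral_cmult) measurable
  also have "\<dots> < \<infinity>"
    using nn_integral_one_minus_exp_finite[OF assms laplace_exponent_nonneg[of 1]]
    unfolding nn_integral_Phi_one_minus_exp[OF assms zero_le_one]
    by (auto simp: ennreal_mult_less_top)
  finally show ?thesis
    using 1 by (simp add: ML1L_def sets_Phi[OF assms])
qed

end

section \<open>Uniqueness of Laplace transforms\<close>

text \<open>The value at t = 0 is the total mass, so the two masses agree and normalization reduces
  the claim to probability laws. Mass 0 cannot be normalized and is treated apart.\<close>

lemma finite_measure_eqI_char:
  assumes M: "finite_measure M" "sets M = sets borel" and N: "finite_measure N" "sets N = sets borel"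
    and char: "\<And>t. char M t = char N t"
  shows "M = N"
proof -
  interpret M: finite_measure M by fact
  interpret N: finite_measure N by fact
  note [measurable_cong, simp] = M(2) N(2)
  have [simp]: "space M = UNIV" "space N = UNIV"
    using M(2) N(2) by (simp_all add: sets_eq_imp_space_eq[of _ borel])
  define m where "m = measure M UNIV"
  have m: "measure N UNIV = m"
    using char[of 0] by (simp add: char_def m_def)
  have em: "emeasure M UNIV = ennreal m" "emeasure N UNIV = ennreal m"
    by (simp_all add: M.emeasure_eq_measure N.emeasure_eq_measure m m_def)
  show ?thesis
  proof (cases "m = 0")
    case True
    show ?thesis
    proof (rule measure_eqI)
      fix A assume "A \<in> sets M"
      then show "emeasure M A = emeasure N A"
        using em emeasure_mono[of A UNIV M] emeasure_mono[of A UNIV N] True by simp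
    qed simp
  next
    case False
    then have pos: "0 < m" using m by (metis measure_nonneg order_le_less)
    define c where "c = ennreal (inverse m)"
    have c: "c * ennreal m = 1" "c \<noteq> 0" "c < top"
      using pos by (simp_all add: c_def ennreal_mult'[symmetric])
    have rd: "real_distribution (density L (\<lambda>_. c))"
      if "sets L = sets borel" "emeasure L UNIV = ennreal m" for L
    proof -
      have "space L = UNIV" using that by (simp add: sets_eq_imp_space_eq[of L borel])
      then have "emeasure (density L (\<lambda>_. c)) (space (density L (\<lambda>_. c))) = 1"
        using c that by (simp add: emeasure_density)
      then have "prob_space (density L (\<lambda>_. c))"
        by (intro prob_spaceI)
      then show ?thesis
        using that by (intro real_distribution.intro real_distribution_axioms.intro) auto
    qed
    have ch: "char (density L (\<lambda>_. c)) t = inverse m *\<^sub>R char L t" if [measurable_cong]: "sets L = sets borel" for L t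
      using pos unfolding char_def c_def by (subst integral_density) (auto simp del: scaleR_conv_of_real)
    have eq: "density M (\<lambda>_. c) = density N (\<lambda>_. c)"
      using em char by (intro Levy_uniqueness rd ext) (auto simp: ch)
    show ?thesis
    proof (rule measure_eqI)
      fix A assume "A \<in> sets M"
      have "c * emeasure M A = c * emeasure N A"
        using arg_cong[OF eq, of "\<lambda>L. emeasure L A"] \<open>A \<in> sets M\<close>
        by (simp add: emeasure_density_const)
      then show "emeasure M A = emeasure N A"
        using c by (auto simp: ennreal_mult_cancel_left)
    qed simp
  qed
qed

text \<open>The Lipschitz constant does not depend on x, so it serves as a dominating constant for
  difference quotients under the integral.\<close>

lemma norm_exp_diff_le:
  fixes w z :: complex and x a :: real
  assumes "0 \<le> x" "0 < a" "a \<le> Re w" "a \<le> Re z"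
  shows "norm (exp (- (w * of_real x)) - exp (- (z * of_real x))) \<le> inverse a * norm (w - z)"
proof (rule field_differentiable_bound)
  show "convex {z. a \<le> Re z}"
    using convex_halfspace_Re_ge[of a] by (simp add: ge_eq_refl)
  fix y assume y: "y \<in> {z. a \<le> Re z}"
  show "((\<lambda>z. exp (- (z * of_real x))) has_field_derivative - of_real x * exp (- (y * of_real x))) (at y within {z. a \<le> Re z})"
    by (auto intro!: derivative_eq_intros)
  \<comment> \<open>The derivative has modulus \<open>x * exp (- (Re y * x))\<close>; the
    exponential decay absorbs the factor x at the cost of \<open>inverse a\<close>.\<close>
  have "a * x \<le> exp (a * x)"
    using exp_ge_add_one_self[of "a * x"] by linarith
  also have "\<dots> \<le> exp (Re y * x)"
    using y assms by (auto intro!: mult_right_mono)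
  finally have "a * (x * exp (- (Re y * x))) \<le> 1"
    by (simp add: exp_minus field_simps)
  then show "norm (- of_real x * exp (- (y * of_real x))) \<le> inverse a"
    using assms by (simp add: norm_mult field_simps)
qed (use assms in auto)

lemma holomorphic_on_complex_laplace:
  assumes M: "finite_measure M" and [measurable_cong]: "sets M = sets borel" and pos: "AE x in M. 0 \<le> x"
  shows "(\<lambda>z. \<integral>x. exp (- (z * complex_of_real x)) \<partial>M) holomorphic_on {z. 0 < Re z}"
proof -
  interpret finite_measure M by fact
  let ?e = "\<lambda>z x. exp (- (z * complex_of_real x))"
  let ?H = "\<lambda>z. \<integral>x. ?e z x \<partial>M"
  have int: "integrable M (?e z)" if "0 \<le> Re z" for z
  proof (rule integrable_const_bound[of _ 1])
    show "AE x in M. norm (?e z x) \<le> 1"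
      using pos by eventually_elim (use that in auto)
  qed measurable
  have "(?H has_field_derivative (\<integral>x. - of_real x * ?e z x \<partial>M)) (at z)" if z: "0 < Re z" for z
  proof -
    \<comment> \<open>Half the distance to the boundary: points with real part above a form a
      neighbourhood of z on which the Lipschitz bound is uniform.\<close>
    define a where "a = Re z / 2"
    have a: "0 < a" "a \<le> Re z" using z by (auto simp: a_def)
    have "((\<lambda>w. (?H w - ?H z) / (w - z)) \<longlongrightarrow> (\<integral>x. - of_real x * ?e z x \<partial>M)) (at z within {w. a < Re w})"
      unfolding tendsto_at_iff_sequentially comp_def
    proof safe
      fix X assume X: "\<forall>i. X i \<in> {w. a < Re w} - {z}" "X \<longlonglongrightarrow> z"
      have "(\<lambda>i. \<integral>x. (?e (X i) x - ?e z x) / (X i - z) \<partial>M) \<longlonglongrightarrow> (\<integral>x. - of_real x * ?e z x \<partial>M)"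
      proof (rule integral_dominated_convergence[where w="\<lambda>_. inverse a"])
        have "((\<lambda>w. (?e w x - ?e z x) / (w - z)) \<longlongrightarrow> - of_real x * ?e z x) (at z)" for x
        proof -
          have "((\<lambda>w. ?e w x) has_field_derivative - of_real x * ?e z x) (at z)"
            by (auto intro!: derivative_eq_intros)
          then show ?thesis by (simp only: has_field_derivative_iff)
        qed
        then have "(\<lambda>i. (?e (X i) x - ?e z x) / (X i - z)) \<longlonglongrightarrow> - of_real x * ?e z x" for x
          unfolding tendsto_at_iff_sequentially comp_def using X by blast
        then show "AE x in M. (\<lambda>i. (?e (X i) x - ?e z x) / (X i - z)) \<longlonglongrightarrow> - of_real x * ?e z x"
          by simp
        fix i
        have i: "a \<le> Re (X i)" "X i \<noteq> z" using X(1) by (auto simp: less_imp_le)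
        show "AE x in M. norm ((?e (X i) x - ?e z x) / (X i - z)) \<le> inverse a"
          using pos
        proof eventually_elim
          case (elim x)
          show ?case
            using norm_exp_diff_le[OF elim a(1) i(1) a(2)] i(2) by (simp add: norm_divide divide_le_eq)
        qed
      qed auto
      moreover have "(\<integral>x. (?e (X i) x - ?e z x) / (X i - z) \<partial>M) = (?H (X i) - ?H z) / (X i - z)" for i
      proof -
        have "0 \<le> Re (X i)" using X(1) a by (auto intro: less_imp_le less_trans)
        then show ?thesis using int[of "X i"] int[of z] z by simp
      qed
      ultimately show "(\<lambda>i. (?H (X i) - ?H z) / (X i - z)) \<longlonglongrightarrow> (\<integral>x. - of_real x * ?e z x \<partial>M)"
        by (simp only:)
    qed
    moreover have "at z within {w. a < Re w} = at z"
      using z by (intro at_within_open open_halfspace_Re_gt) (auto simp: a_def)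
    ultimately show ?thesis
      by (simp add: has_field_derivative_iff)
  qed
  then show ?thesis
    by (subst holomorphic_on_open) (auto simp: open_halfspace_Re_gt)
qed

text \<open>The difference of the two transforms is holomorphic on the right half-plane, hence vanishes
  there; its boundary values on the imaginary axis are characteristic functions.\<close>

lemma finite_measure_eqI_laplace:
  assumes M: "finite_measure M" "sets M = sets borel" "AE x in M. 0 \<le> x"
    and N: "finite_measure N" "sets N = sets borel" "AE x in N. 0 \<le> x"
    and d: "0 < d" and eq: "\<And>u. 0 < u \<Longrightarrow> u < d \<Longrightarrow> laplace M u = laplace N u"
  shows "M = N"
proof (rule finite_measure_eqI_char[OF M(1,2) N(1,2)])
  let ?e = "\<lambda>z x. exp (- (z * complex_of_real x))"
  define H where "H L z = (\<integral>x. ?e z x \<partial>L)" for L :: "real measure" and z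
  have real: "H L (of_real u) = of_real (laplace L u)" for L u
    unfolding H_def laplace_def integral_complex_of_real[symmetric]
    by (intro Bochner_Integration.integral_cong) (auto simp: exp_of_real[symmetric])
  have "H M z - H N z = 0" if "0 < Re z" for z
  proof (rule analytic_continuation[where f="\<lambda>z. H M z - H N z" and U="complex_of_real ` {0<..<d}"])
    show "(\<lambda>z. H M z - H N z) holomorphic_on {z. 0 < Re z}"
      unfolding H_def by (intro holomorphic_intros holomorphic_on_complex_laplace M N)
    show "open {z. 0 < Re z}" by (rule open_halfspace_Re_gt)
    show "connected {z. 0 < Re z}" by (intro convex_connected convex_halfspace_Re_gt)
    show "complex_of_real ` {0<..<d} \<subseteq> {z. 0 < Re z}" by auto
    show "complex_of_real (d / 2) \<in> {z. 0 < Re z}" using d by simp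
    show "complex_of_real (d / 2) islimpt complex_of_real ` {0<..<d}"
      unfolding islimpt_approachable
    proof safe
      fix e :: real assume "0 < e"
      \<comment> \<open>The offset is positive, smaller than e, and at most \<open>d / 4\<close>, so
        r differs from the centre but stays in the interval.\<close>
      define r where "r = d / 2 + min (e / 2) (d / 4)"
      have r: "r \<in> {0<..<d}" "r \<noteq> d / 2" "dist r (d / 2) < e"
        using d \<open>0 < e\<close> by (auto simp: r_def dist_real_def min_def)
      then show "\<exists>x'\<in>complex_of_real ` {0<..<d}. x' \<noteq> complex_of_real (d / 2) \<and> dist x' (complex_of_real (d / 2)) < e"
        by (intro bexI[of _ "complex_of_real r"]) (simp_all only: dist_of_real of_real_eq_iff imageI simp_thms)
    qed
    show "H M z - H N z = 0" if "z \<in> complex_of_real ` {0<..<d}" for z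
      using that eq by (auto simp: real)
  qed (use that in auto)
  then have half: "H M z = H N z" if "0 < Re z" for z
    using that by simp
  \<comment> \<open>The arguments approach \<open>- \<i> * t\<close> from inside the half-plane; the
    minus sign cancels the one in the Laplace kernel and yields \<open>iexp (t * x)\<close>.\<close>
  have char: "(\<lambda>n. H L (of_real (inverse (real (Suc n))) - \<i> * of_real t)) \<longlonglongrightarrow> char L t"
    if L: "finite_measure L" "sets L = sets borel" "AE x in L. 0 \<le> x" for L t
  proof -
    interpret finite_measure L by fact
    note [measurable_cong] = L(2)
    show ?thesis
      unfolding H_def char_def
    proof (rule integral_dominated_convergence[where w="\<lambda>_. 1"])
      have "(\<lambda>n. ?e (of_real (inverse (real (Suc n))) - \<i> * of_real t) x) \<longlonglongrightarrow> ?e (of_real 0 - \<i> * of_real t) x" for x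
        by (intro tendsto_intros LIMSEQ_inverse_real_of_nat)
      then show "AE x in L. (\<lambda>n. ?e (of_real (inverse (real (Suc n))) - \<i> * of_real t) x) \<longlonglongrightarrow> iexp (t * x)"
        by (simp add: mult.assoc)
      show "AE x in L. norm (?e (of_real (inverse (real (Suc n))) - \<i> * of_real t) x) \<le> 1" for n
        using L(3) by eventually_elim (auto simp del: of_nat_Suc)
    qed auto
  qed
  show "char M t = char N t" for t
  proof (rule LIMSEQ_unique[OF char[OF M] ])
    show "(\<lambda>n. H M (of_real (inverse (real (Suc n))) - \<i> * of_real t)) \<longlonglongrightarrow> char N t"
      using char[OF N, of t] by (subst half) (auto simp del: of_nat_Suc)
  qed
qed

section \<open>Injectivity and the image\<close>

lemma (in real_distribution) eq_return:
  assumes "AE x in M. x = b"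
  shows "M = return borel b"
proof -
  have "char M = char (return borel b)"
  proof
    fix t
    have "char M t = (\<integral>x. iexp (t * b) \<partial>M)"
      unfolding char_def using assms by (intro integral_cong_AE) auto
    then show "char M t = char (return borel b) t"
      by (simp add: char_return prob_space[unfolded space_eq_univ])
  qed
  then show ?thesis
    by (intro Levy_uniqueness real_distribution_axioms real_distribution_return)
qed

text \<open>Two independent copies whose sum only takes the values 0 and c satisfy, almost surely,
  y = c - x or x = y = 0; fixing one value of x makes y constant.\<close>

lemma return_if_convolution_two_points:
  assumes N: "nonneg_distribution N" and conv: "emeasure (convolution N N) (- {0, c}) = 0"
  shows "\<exists>b\<ge>0. N = return borel b"
proof -
  interpret nonneg_distribution N by fact
  interpret pair_prob_space N N ..
  have "AE z in convolution N N. z = 0 \<or> z = c"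
    using conv by (intro AE_I[of _ _ "- {0, c}"]) auto
  then have "AE z in N \<Otimes>\<^sub>M N. fst z + snd z = 0 \<or> fst z + snd z = c"
    unfolding convolution_def by (subst (asm) AE_distr_iff) (auto simp: case_prod_beta)
  then have AE2: "AE x in N. AE y in N. x + y = 0 \<or> x + y = c"
    by (rule AE_pair[where Q="\<lambda>z. fst z + snd z = 0 \<or> fst z + snd z = c", unfolded fst_conv snd_conv])
  have "\<exists>b. AE y in N. y = b"
  proof (cases "AE x in N. x = 0")
    case False
    have "\<exists>x. 0 < x \<and> (AE y in N. x + y = 0 \<or> x + y = c)"
    proof (rule ccontr)
      assume *: "\<not> ?thesis"
      have "AE x in N. x = 0"
        using AE2 AE_nonneg
      proof eventually_elim
        case (elim x)
        with * have "\<not> 0 < x" by blast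
        with elim(2) show ?case by simp
      qed
      with False show False by simp
    qed
    then obtain x where x: "0 < x" "AE y in N. x + y = 0 \<or> x + y = c" by blast
    have "AE y in N. y = c - x"
      using x(2) AE_nonneg by eventually_elim (use x(1) in auto)
    then show ?thesis ..
  qed auto
  then obtain b where b: "AE y in N. y = b" ..
  have "AE y in N. 0 \<le> b"
    using b AE_nonneg by eventually_elim simp
  then have "0 \<le> b" by simp
  with eq_return[OF b] show ?thesis by blast
qed

lemma return_in_ML1L: "0 < x \<Longrightarrow> return borel x \<in> ML1L"
  by (simp add: ML1L_def nn_integral_return)

context nonneg_ID
begin

text \<open>If the exponent vanished at 1, the nonnegative integrand \<open>1 - exp (- x)\<close>
  would have integral 0, forcing x = 0 almost surely. Positivity makes the interval of attained
  exponents nondegenerate.\<close>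

lemma laplace_exponent_1_pos:
  assumes "M \<noteq> return borel 0"
  shows "0 < laplace_exponent 1"
proof (rule ccontr)
  assume "\<not> 0 < laplace_exponent 1"
  then have "laplace M 1 = 1"
    using laplace_mu_pow[of 1 1] laplace_exponent_nonneg[of 1] by (simp add: mu_pow_1)
  then have "(\<integral>\<^sup>+x. ennreal (1 - exp (- x)) \<partial>M) = 0"
    using nn_integral_one_minus_exp[of 1] by simp
  then have "AE x in M. ennreal (1 - exp (- x)) = 0"
    by (subst (asm) nn_integral_0_iff_AE) auto
  then have "AE x in M. x = 0"
    using AE_nonneg by eventually_elim (auto simp: ennreal_eq_0_iff)
  from eq_return[OF this] assms show False by simp
qed

lemma laplace_exponent_surj:
  assumes "0 \<le> z" "z \<le> laplace_exponent 1"
  obtains u where "0 \<le> u" "laplace_exponent u = z"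
proof -
  have "\<exists>u\<ge>0. u \<le> 1 \<and> laplace_exponent u = z"
    using assms by (intro IVT') (auto simp: laplace_exponent_0 intro: continuous_on_subset[OF continuous_on_laplace_exponent])
  then show ?thesis using that by blast
qed

text \<open>The weight 1 - exp (-s d) turns the possibly infinite measure into a finite one, whose
  Laplace transform at z is a difference of two values of the integral of 1 - exp (-s z).\<close>

lemma inj_on_Phi:
  assumes "M \<noteq> return borel 0"
  shows "inj_on (Phi M) ML1L"
proof (rule inj_onI)
  fix \<rho> \<rho>' assume \<rho>: "\<rho> \<in> ML1L" "\<rho>' \<in> ML1L" and Phi: "Phi M \<rho> = Phi M \<rho>'"
  \<comment> \<open>Half of the known range, so that for z below d both z and \<open>z + d\<close>
    are values of the exponent.\<close>
  define d where "d = laplace_exponent 1 / 2"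
  have d: "0 < d" using laplace_exponent_1_pos[OF assms] by (simp add: d_def)
  define F where "F L z = (\<integral>\<^sup>+s. ennreal (1 - exp (- (s * z))) \<partial>L)" for L :: "real measure" and z
  define \<tau> where "\<tau> L = density L (\<lambda>s. ennreal (1 - exp (- (s * d))))" for L :: "real measure"
  have F: "F \<rho> z = F \<rho>' z" if z: "0 \<le> z" "z \<le> 2 * d" for z
  proof -
    obtain u where u: "0 \<le> u" "laplace_exponent u = z"
      using laplace_exponent_surj[of z] z by (auto simp: d_def)
    show ?thesis
      using nn_integral_Phi_one_minus_exp[OF \<rho>(1) u(1)] nn_integral_Phi_one_minus_exp[OF \<rho>(2) u(1)] Phi
      by (simp add: F_def u)
  qed
  \<comment> \<open>The transform identity is written as a sum because F takes values in
    \<open>ennreal\<close>, where subtraction is truncated.\<close>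
  have \<tau>: "finite_measure (\<tau> L)" "sets (\<tau> L) = sets borel" "AE s in \<tau> L. 0 \<le> s"
    and lap: "0 \<le> z \<Longrightarrow> ennreal (laplace (\<tau> L) z) + F L z = F L (z + d)"
    and recover: "density (\<tau> L) (\<lambda>s. inverse (ennreal (1 - exp (- (s * d))))) = L"
    if L: "L \<in> ML1L" for L z
  proof -
    note [measurable_cong] = ML1L_D(1)[OF L]
    have pos: "AE s in L. 0 < s" by (rule ML1L_D(3)[OF L])
    have "emeasure (\<tau> L) (space (\<tau> L)) = F L d"
      by (simp add: \<tau>_def F_def emeasure_density ML1L_D[OF L])
    also have "\<dots> < \<infinity>"
      unfolding F_def using nn_integral_one_minus_exp_finite[OF L] d by simp
    finally show fin: "finite_measure (\<tau> L)" by (intro finite_measureI) simp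
    show sets: "sets (\<tau> L) = sets borel" by (simp add: \<tau>_def ML1L_D[OF L])
    show nonneg: "AE s in \<tau> L. 0 \<le> s"
      unfolding \<tau>_def using pos by (subst AE_density) (auto elim: eventually_mono)
    show "ennreal (laplace (\<tau> L) z) + F L z = F L (z + d)" if z: "0 \<le> z"
    proof -
      interpret \<tau>: finite_measure "\<tau> L" by fact
      note [measurable_cong] = sets
      have "ennreal (laplace (\<tau> L) z) = (\<integral>\<^sup>+s. ennreal (exp (- (z * s))) \<partial>\<tau> L)"
        unfolding laplace_def
      proof (rule nn_integral_eq_integral[symmetric])
        show "integrable (\<tau> L) (\<lambda>s. exp (- (z * s)))"
        proof (rule \<tau>.integrable_const_bound[of _ 1])
          show "AE s in \<tau> L. norm (exp (- (z * s))) \<le> 1"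
            using nonneg by eventually_elim (use z in auto)
        qed measurable
      qed auto
      also have "\<dots> = (\<integral>\<^sup>+s. ennreal (1 - exp (- (s * d))) * ennreal (exp (- (z * s))) \<partial>L)"
        unfolding \<tau>_def by (intro nn_integral_density) measurable
      finally have "ennreal (laplace (\<tau> L) z) + F L z =
        (\<integral>\<^sup>+s. ennreal (1 - exp (- (s * d))) * ennreal (exp (- (z * s))) + ennreal (1 - exp (- (s * z))) \<partial>L)"
        unfolding F_def by (simp add: nn_integral_add)
      also have "\<dots> = F L (z + d)"
        unfolding F_def
      proof (rule nn_integral_cong_AE)
        show "AE s in L. ennreal (1 - exp (- (s * d))) * ennreal (exp (- (z * s))) + ennreal (1 - exp (- (s * z)))
          = ennreal (1 - exp (- (s * (z + d))))"
          using pos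
        proof eventually_elim
          case (elim s)
          then have "0 \<le> 1 - exp (- (s * d))" "0 \<le> 1 - exp (- (s * z))"
            using d z by auto
          moreover have "(1 - exp (- (s * d))) * exp (- (z * s)) + (1 - exp (- (s * z))) = 1 - exp (- (s * (z + d)))"
            by (simp add: algebra_simps exp_add[symmetric])
          ultimately show ?case
            by (simp only: ennreal_mult'[symmetric] ennreal_plus[symmetric] mult_nonneg_nonneg exp_ge_zero)
        qed
      qed
      finally show ?thesis .
    qed
    \<comment> \<open>The weight is positive exactly for s > 0, hence almost everywhere for measures
      in \<open>ML1L\<close>, and dividing by it restores the measure.\<close>
    have cancel: "ennreal x * inverse (ennreal x) = 1" if "0 < x" for x
      using that by (simp add: inverse_ennreal ennreal_mult'[symmetric])
    have "density (\<tau> L) (\<lambda>s. inverse (ennreal (1 - exp (- (s * d))))) =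
      density L (\<lambda>s. ennreal (1 - exp (- (s * d))) * inverse (ennreal (1 - exp (- (s * d)))))"
      unfolding \<tau>_def by (subst density_density_eq) auto
    also have "\<dots> = density L (\<lambda>_. 1)"
    proof (rule density_cong)
      show "AE s in L. ennreal (1 - exp (- (s * d))) * inverse (ennreal (1 - exp (- (s * d)))) = 1"
        using pos
      proof eventually_elim
        case (elim s)
        then have "0 < 1 - exp (- (s * d))" using d by simp
        then show ?case by (rule cancel)
      qed
    qed auto
    finally show "density (\<tau> L) (\<lambda>s. inverse (ennreal (1 - exp (- (s * d))))) = L"
      by (simp add: density_1)
  qed
  have "\<tau> \<rho> = \<tau> \<rho>'"
  proof (rule finite_measure_eqI_laplace[OF \<tau>[OF \<rho>(1)] \<tau>[OF \<rho>(2)] d])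
    fix u assume u: "0 < u" "u < d"
    \<comment> \<open>Finiteness is what permits cancelling this term in
      \<open>ennreal\<close>.\<close>
    have "F \<rho> u < \<infinity>"
      unfolding F_def using nn_integral_one_minus_exp_finite[OF \<rho>(1)] u by simp
    moreover have "F \<rho> u + ennreal (laplace (\<tau> \<rho>) u) = F \<rho> u + ennreal (laplace (\<tau> \<rho>') u)"
      using lap[OF \<rho>(1), of u] lap[OF \<rho>(2), of u] F[of u] F[of "u + d"] u by (simp add: add.commute)
    ultimately have "ennreal (laplace (\<tau> \<rho>) u) = ennreal (laplace (\<tau> \<rho>') u)"
      unfolding ennreal_add_left_cancel by auto
    moreover have "0 \<le> laplace L u" for L by (simp add: laplace_def)
    ultimately show "laplace (\<tau> \<rho>) u = laplace (\<tau> \<rho>') u"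
      by simp
  qed
  with recover[OF \<rho>(1)] recover[OF \<rho>(2)] show "\<rho> = \<rho>'" by (metis (no_types))
qed

lemma return_not_in_Phi_image:
  assumes "\<not> (\<exists>a. M = return borel a)"
  shows "return borel 1 \<notin> Phi M ` ML1L"
proof
  assume "return borel 1 \<in> Phi M ` ML1L"
  then obtain \<rho> where \<rho>: "\<rho> \<in> ML1L" "Phi M \<rho> = return borel 1" by auto
  note [measurable_cong] = ML1L_D(1)[OF \<rho>(1)]
  have "(\<integral>\<^sup>+s. emeasure (kernel s) (- {0, 1}) \<partial>\<rho>) = 0"
    using emeasure_Phi[OF \<rho>(1), of "- {0, 1}"] \<rho>(2) by simp
  moreover have "(\<lambda>s. emeasure (kernel s) (- {0, 1})) \<in> borel_measurable \<rho>"
    by measurable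
  ultimately have AE: "AE s in \<rho>. emeasure (kernel s) (- {0, 1}) = 0"
    by (simp add: nn_integral_0_iff_AE)
  \<comment> \<open>Otherwise \<rho> would be the null measure, and so would its image, which
    however gives mass 1 to \<open>{1}\<close>.\<close>
  have "\<exists>s>0. emeasure (kernel s) (- {0, 1}) = 0"
  proof (rule ccontr)
    assume *: "\<not> ?thesis"
    have "AE s in \<rho>. False"
      using AE ML1L_D(3)[OF \<rho>(1)] by eventually_elim (use * in auto)
    then have "(\<integral>\<^sup>+s. emeasure (kernel s) {1} \<partial>\<rho>) = (\<integral>\<^sup>+s. 0 \<partial>\<rho>)"
      by (intro nn_integral_cong_AE) (auto elim: eventually_mono)
    then show False
      using emeasure_Phi[OF \<rho>(1), of "{1}"] \<rho>(2) by simp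
  qed
  then obtain s where s: "0 < s" "emeasure (mu_pow M (s / 2 + s / 2)) (- {0, 1}) = 0"
    by (auto simp: kernel_def)
  then obtain b where b: "mu_pow M (s / 2) = return borel b"
    using return_if_convolution_two_points[OF nonneg_distribution_mu_pow, of "s / 2" 1] mu_pow_add[of "s / 2" "s / 2"]
    by auto
  \<comment> \<open>Degeneracy is carried from mu^(s/2) to mu through the exponent, which becomes
    linear in u; a linear exponent is that of a Dirac measure.\<close>
  have exponent: "laplace_exponent u = u * (2 * b / s)" if "0 \<le> u" for u
  proof -
    have "exp (- (s / 2 * laplace_exponent u)) = exp (- (u * b))"
      using laplace_mu_pow[OF that, of "s / 2"] s b by (simp add: laplace_return)
    then have "s / 2 * laplace_exponent u = u * b" by simp
    then show ?thesis using s by (auto simp: field_simps)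
  qed
  \<comment> \<open>The candidate Dirac measure must lie on the half-line for Laplace uniqueness to
    apply.\<close>
  have "0 \<le> b"
    using exponent[of 1] laplace_exponent_nonneg[of 1] s by (simp add: zero_le_divide_iff)
  have "M = return borel (2 * b / s)"
  proof (rule finite_measure_eqI_laplace[where d=1])
    interpret R: nonneg_distribution "return borel (2 * b / s)"
      using \<open>0 \<le> b\<close> s by (intro nonneg_distribution_return) auto
    show "finite_measure (return borel (2 * b / s))" "AE x in return borel (2 * b / s). 0 \<le> x"
      by (rule R.finite_measure_axioms, rule R.AE_nonneg)
    fix u :: real assume "0 < u"
    then show "laplace M u = laplace (return borel (2 * b / s)) u"
      using laplace_mu_pow[of u 1] exponent[of u] by (simp add: laplace_return mu_pow_1)
  qed (auto intro: finite_measure_axioms AE_nonneg)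
  with assms show False by blast
qed

end

theorem theorem3p3:
  fixes \<mu> :: "real measure"
  assumes "ID \<mu>"
    and "emeasure \<mu> {..<0} = 0"
    and "\<not> (\<exists>a. \<mu> = return borel a)"
  shows "inj_on (Phi \<mu>) ML1L \<and> Phi \<mu> ` ML1L \<subset> ML1L"
proof -
  have "real_distribution \<mu>" using assms(1) by (simp add: ID_def)
  then interpret nonneg_ID \<mu>
    using assms by (intro nonneg_ID.intro nonneg_distributionI nonneg_ID_axioms.intro)
  show ?thesis
    using inj_on_Phi Phi_in_ML1L return_not_in_Phi_image return_in_ML1L[of 1] assms(3) by auto
qed

end
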